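(* Let $\Gamma=(V,E)$ be a finite connected simple graph regular of degree $d\ge1$ and $\Gamma'=(V',E')$ a finite connected simple graph regular of degree $d'\ge1$, with $m=|V|$, $n=|V'|$. Let $0=\lambda'_0<\lambda'_1\le\cdots\le\lambda'_{n-1}$ be the eigenvalues of the normalized Laplacian of $\Gamma'$. Let $C$ be the circle $\{\alpha\in\mathbb{C}:|\alpha-(d'+d'\lambda'_1/2)|=d'\}$, traversed clockwise. Let $\mathcal{G}_\alpha,\mathcal{G}$ (resp. $\mathcal{G}'_\alpha,\mathcal{G}'$) be the generalized and normalized Green's functions of $\Gamma$ (resp. $\Gamma'$), and $\mathbf{G}$ the normalized Green's function of $\Gamma\times\Gamma'$. Then for all $x,y\in V$, $x',y'\in V'$, $$\mathbf{G}((x,x'),(y,y'))=\frac{d+d'}{2\pi i\,dd'}\int_C\mathcal{G}_{\alpha/d}(x,y)\,\mathcal{G}'_{-\alpha/d'}(x',y')\,d\alpha+\frac{d+d'}{dn}\mathcal{G}(x,y)+\frac{d+d'}{d'm}\mathcal{G}'(x',y').$$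
   Context: For a connected $\delta$-regular graph $\Gamma=(V,E)$, the normalized Laplacian $\mathcal{L}$ is the $V\times V$ matrix with $\mathcal{L}(x,x)=1$, $\mathcal{L}(x,y)=-1/\delta$ if $x\sim y$, $0$ otherwise. Let $\{(\lambda_j,\phi_j)\}$ be an orthonormal eigensystem of $\mathcal{L}$ (possibly complex eigenvectors, orthonormal for $\langle f,g\rangle=\sum f\overline g$). For $\alpha\in\mathbb{C}$ with $-\alpha$ not a positive eigenvalue, the generalized Green's function is $\mathcal{G}_\alpha(x,y)=\sum_{j:\lambda_j>0}\frac{1}{\lambda_j+\alpha}\phi_j(x)\overline{\phi_j(y)}$, and the normalized Green's function is $\mathcal{G}=\mathcal{G}_0$. The Cartesian product $\Gamma\times\Gamma'$ has vertex set $V\times V'$ with $(v,v')\sim(u,u')$ iff ($v=u$, $v'\sim u'$) or ($v'=u'$, $v\sim u$); it is $(d+d')$-regular and its normalized Green's function is defined in the same way from its normalized Laplacian. *)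

theory Defs
  imports
    "Graph_Theory.Graph_Theory"
    "HOL-Complex_Analysis.Complex_Analysis"
begin

text \<open>
  A finite simple graph is a \<^locale>\<open>pair_graph\<close>: a finite, loop-free, symmetric arc relation,
  so that every undirected edge is represented by its two orientations and the degree of a
  vertex is its out-degree.
\<close>

definition regular_graph :: "'a pair_pre_digraph \<Rightarrow> nat \<Rightarrow> bool" where
  "regular_graph G \<delta> \<longleftrightarrow> (\<forall>v \<in> pverts G. out_degree (with_proj G) v = \<delta>)"

definition cartesian_product ::
    "'a pair_pre_digraph \<Rightarrow> 'b pair_pre_digraph \<Rightarrow> ('a \<times> 'b) pair_pre_digraph" where
  "cartesian_product G H =
     \<lparr> pverts = pverts G \<times> pverts H,
       parcs = {((v, v'), (u, u')) | v v' u u'.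
                  (v = u \<and> v \<in> pverts G \<and> (v', u') \<in> parcs H) \<or>
                  (v' = u' \<and> v' \<in> pverts H \<and> (v, u) \<in> parcs G)} \<rparr>"

text \<open>The argument \<open>\<delta>\<close> is the degree of the regular graph \<open>G\<close>.\<close>

definition normalized_laplacian :: "'a pair_pre_digraph \<Rightarrow> nat \<Rightarrow> 'a \<Rightarrow> 'a \<Rightarrow> complex" where
  "normalized_laplacian G \<delta> x y =
     (if x = y then 1 else if (x, y) \<in> parcs G then - 1 / of_nat \<delta> else 0)"

text \<open>
  The eigenpairs \<open>(lam j, phi j)\<close> are indexed by \<open>j < |V|\<close>, so the \<open>phi j\<close> form an orthonormal
  basis of the functions on \<open>V\<close> and eigenvalues are listed with multiplicity. The matrix is
  Hermitian, so its eigenvalues are taken to be real from the outset.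
\<close>

definition orthonormal_eigensystem ::
    "'a pair_pre_digraph \<Rightarrow> nat \<Rightarrow> (nat \<Rightarrow> real) \<Rightarrow> (nat \<Rightarrow> 'a \<Rightarrow> complex) \<Rightarrow> bool" where
  "orthonormal_eigensystem G \<delta> lam phi \<longleftrightarrow>
     (\<forall>j < card (pverts G). \<forall>x \<in> pverts G.
        (\<Sum>y \<in> pverts G. normalized_laplacian G \<delta> x y * phi j y) = of_real (lam j) * phi j x) \<and>
     (\<forall>i < card (pverts G). \<forall>j < card (pverts G).
        (\<Sum>x \<in> pverts G. phi i x * cnj (phi j x)) = (if i = j then 1 else 0))"

definition generalized_green ::
    "'a pair_pre_digraph \<Rightarrow> (nat \<Rightarrow> real) \<Rightarrow> (nat \<Rightarrow> 'a \<Rightarrow> complex) \<Rightarrow>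
     complex \<Rightarrow> 'a \<Rightarrow> 'a \<Rightarrow> complex" where
  "generalized_green G lam phi \<alpha> x y =
     (\<Sum>j | j < card (pverts G) \<and> lam j > 0.
        1 / (of_real (lam j) + \<alpha>) * phi j x * cnj (phi j y))"

definition normalized_green ::
    "'a pair_pre_digraph \<Rightarrow> (nat \<Rightarrow> real) \<Rightarrow> (nat \<Rightarrow> 'a \<Rightarrow> complex) \<Rightarrow> 'a \<Rightarrow> 'a \<Rightarrow> complex" where
  "normalized_green G lam phi = generalized_green G lam phi 0"

end

theory Submission
  imports Defs "Jordan_Normal_Form.Determinant"
begin

text \<open>
  The products \<open>\<phi>\<^sub>i \<otimes> \<phi>'\<^sub>j\<close> form an orthonormal eigenbasis of the product graph, with eigenvalues
  \<open>(d \<lambda>\<^sub>i + d' \<lambda>'\<^sub>j) / (d + d')\<close>. The Green's function, being a function of the Laplacian, does not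
  depend on the eigenbasis, so it may be computed from this one. Connectedness forces the
  projection onto the kernel of each factor's Laplacian to be \<open>1/m\<close> (resp. \<open>1/n\<close>) in every entry, and the terms
  in which exactly one of \<open>\<lambda>\<^sub>i\<close>, \<open>\<lambda>'\<^sub>j\<close> vanishes become the two multiples of \<open>\<G>\<close> and \<open>\<G>'\<close>.
  In the remaining terms \<open>1 / (d \<lambda>\<^sub>i + d' \<lambda>'\<^sub>j)\<close> is a Cauchy integral: since all eigenvalues lie
  in \<open>[0, 2]\<close>, the circle encloses every \<open>d' \<lambda>'\<^sub>j > 0\<close> and no \<open>- d \<lambda>\<^sub>i\<close>.
\<close>

section \<open>Orthonormal eigenbases of a Hermitian matrix\<close>

text \<open>Since \<open>card I = card V\<close>, the values of \<open>phi\<close> fill a square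
  matrix \<open>A\<close>. Orthonormality says that \<open>A\<close> times its conjugate transpose
  \<open>B\<close> is the identity, and a one-sided inverse of a square matrix is two-sided; the
  entries of \<open>B * A\<close> are the sums wanted here.\<close>

lemma orthonormal_rows_imp_orthonormal_columns:
  fixes phi :: "'i \<Rightarrow> 'a \<Rightarrow> complex"
  assumes "finite V" "finite I" "card I = card V"
    and ortho: "\<And>i j. i \<in> I \<Longrightarrow> j \<in> I \<Longrightarrow>
          (\<Sum>x\<in>V. phi i x * cnj (phi j x)) = (if i = j then 1 else 0)"
    and "x \<in> V" "y \<in> V"
  shows "(\<Sum>i\<in>I. phi i x * cnj (phi i y)) = (if x = y then 1 else 0)"
proof -
  define n where "n = card V"
  obtain e where e: "bij_betw e {0..<n} V"
    using ex_bij_betw_nat_finite[OF assms(1)] n_def by blast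
  obtain g where g: "bij_betw g {0..<n} I"
    using ex_bij_betw_nat_finite[OF assms(2)] assms(3) n_def by auto
  define A where "A = mat n n (\<lambda>(i, k). phi (g i) (e k))"
  define B where "B = mat n n (\<lambda>(k, i). cnj (phi (g i) (e k)))"
  have [simp]: "A \<in> carrier_mat n n" "B \<in> carrier_mat n n"
    by (simp_all add: A_def B_def)
  have "A * B = 1\<^sub>m n"
  proof (rule eq_matI)
    fix i j assume "i < dim_row (1\<^sub>m n :: complex mat)" "j < dim_col (1\<^sub>m n :: complex mat)"
    then have ij: "i < n" "j < n" by auto
    have "(A * B) $$ (i, j) = (\<Sum>k\<in>{0..<n}. phi (g i) (e k) * cnj (phi (g j) (e k)))"
      using ij by (simp add: A_def B_def scalar_prod_def)
    also have "\<dots> = (\<Sum>x\<in>V. phi (g i) x * cnj (phi (g j) x))"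
      by (rule sum.reindex_bij_betw[OF e])
    also have "\<dots> = (if g i = g j then 1 else 0)"
      using ij bij_betwE[OF g] by (intro ortho) auto
    also have "\<dots> = 1\<^sub>m n $$ (i, j)"
      using ij bij_betw_imp_inj_on[OF g] by (auto simp: inj_on_def)
    finally show "(A * B) $$ (i, j) = 1\<^sub>m n $$ (i, j)" .
  qed (auto simp: A_def B_def)
  then have BA: "B * A = 1\<^sub>m n"
    by (intro mat_mult_left_right_inverse[of A]) auto
  obtain k l where kl: "k < n" "l < n" "e k = x" "e l = y"
    using bij_betw_imp_surj_on[OF e] assms(5,6) by force
  have "(\<Sum>i\<in>I. phi i x * cnj (phi i y)) = (\<Sum>i\<in>{0..<n}. phi (g i) x * cnj (phi (g i) y))"
    by (rule sum.reindex_bij_betw[OF g, symmetric])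
  also have "\<dots> = (B * A) $$ (l, k)"
    using kl by (simp add: A_def B_def scalar_prod_def mult.commute)
  also have "\<dots> = (if x = y then 1 else 0)"
    using kl BA bij_betw_imp_inj_on[OF e] by (auto simp: inj_on_def)
  finally show ?thesis .
qed

text \<open>The index set is left abstract because a single graph has its basis indexed by numbers,
  while the tensor basis of a product is indexed by pairs.\<close>

locale eigenbasis =
  fixes V :: "'a set" and L :: "'a \<Rightarrow> 'a \<Rightarrow> complex"
    and I :: "'i set" and lam :: "'i \<Rightarrow> real" and phi :: "'i \<Rightarrow> 'a \<Rightarrow> complex"
  assumes finite_V: "finite V" and finite_I: "finite I" and card_I: "card I = card V"
    and hermitian: "\<And>x y. x \<in> V \<Longrightarrow> y \<in> V \<Longrightarrow> L x y = cnj (L y x)"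
    and eigen: "\<And>i x. i \<in> I \<Longrightarrow> x \<in> V \<Longrightarrow> (\<Sum>y\<in>V. L x y * phi i y) = of_real (lam i) * phi i x"
    and ortho: "\<And>i j. i \<in> I \<Longrightarrow> j \<in> I \<Longrightarrow>
          (\<Sum>x\<in>V. phi i x * cnj (phi j x)) = (if i = j then 1 else 0)"
begin

lemma completeness:
  assumes "x \<in> V" "y \<in> V"
  shows "(\<Sum>i\<in>I. phi i x * cnj (phi i y)) = (if x = y then 1 else 0)"
  using orthonormal_rows_imp_orthonormal_columns[OF finite_V finite_I card_I ortho assms] .

lemma expansion:
  assumes "x \<in> V"
  shows "(\<Sum>i\<in>I. (\<Sum>z\<in>V. f z * cnj (phi i z)) * phi i x) = f x"
proof -
  have "(\<Sum>i\<in>I. (\<Sum>z\<in>V. f z * cnj (phi i z)) * phi i x)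
      = (\<Sum>z\<in>V. f z * (\<Sum>i\<in>I. phi i x * cnj (phi i z)))"
    unfolding sum_distrib_left sum_distrib_right
    by (subst sum.swap) (simp add: mult_ac)
  also have "\<dots> = (\<Sum>z\<in>V. if x = z then f z else 0)"
    by (intro sum.cong refl) (simp add: completeness assms)
  finally show ?thesis using assms finite_V by simp
qed

text \<open>Moving the Hermitian \<open>L\<close> across the inner product multiplies it by \<mu> on
  one side and by \<open>lam i\<close> on the other. Here \<open>f\<close> is any solution of the
  eigenvalue equation, not a basis member, so the result compares two different bases and also
  applies to constant functions.\<close>

lemma eigenvectors_orthogonal:
  assumes f: "\<And>x. x \<in> V \<Longrightarrow> (\<Sum>y\<in>V. L x y * f y) = of_real \<mu> * f x"
    and i: "i \<in> I" and "lam i \<noteq> \<mu>"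
  shows "(\<Sum>x\<in>V. f x * cnj (phi i x)) = 0"
proof -
  have "of_real \<mu> * (\<Sum>x\<in>V. f x * cnj (phi i x)) = (\<Sum>x\<in>V. (\<Sum>y\<in>V. L x y * f y) * cnj (phi i x))"
    by (simp add: f sum_distrib_left mult.assoc)
  also have "\<dots> = (\<Sum>y\<in>V. f y * (\<Sum>x\<in>V. L x y * cnj (phi i x)))"
    unfolding sum_distrib_left sum_distrib_right
    by (subst sum.swap) (simp add: mult_ac)
  also have "\<dots> = (\<Sum>y\<in>V. f y * cnj (\<Sum>x\<in>V. L y x * phi i x))"
    unfolding cnj_sum complex_cnj_mult
    by (intro sum.cong arg_cong2[where f = "(*)"] refl) (rule hermitian)
  also have "\<dots> = of_real (lam i) * (\<Sum>x\<in>V. f x * cnj (phi i x))"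
    by (simp add: eigen i sum_distrib_left mult_ac)
  finally show ?thesis using assms(3) by simp
qed

end

text \<open>Both sides are the kernel of the operator \<open>F(L)\<close>. The overlap
  \<open>c i j\<close> of the two bases vanishes unless \<open>lam i = mu j\<close>, so after
  expanding one basis in the other, \<open>F (lam i)\<close> may be exchanged for
  \<open>F (mu j)\<close>.\<close>

lemma spectral_function_unique:
  fixes F :: "real \<Rightarrow> complex"
  assumes "eigenbasis V L I lam phi" and "eigenbasis V L J mu psi"
    and x: "x \<in> V" and y: "y \<in> V"
  shows "(\<Sum>i\<in>I. F (lam i) * phi i x * cnj (phi i y)) = (\<Sum>j\<in>J. F (mu j) * psi j x * cnj (psi j y))"
proof -
  interpret A: eigenbasis V L I lam phi by fact
  interpret B: eigenbasis V L J mu psi by fact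
  define c where "c i j = (\<Sum>z\<in>V. phi i z * cnj (psi j z))" for i j
  have F_eq: "F (lam i) * c i j = F (mu j) * c i j" if "i \<in> I" "j \<in> J" for i j
    using B.eigenvectors_orthogonal[OF A.eigen[OF that(1)] that(2)] unfolding c_def by fastforce
  have "(\<Sum>i\<in>I. F (lam i) * phi i x * cnj (phi i y))
      = (\<Sum>i\<in>I. F (lam i) * phi i x * cnj (\<Sum>j\<in>J. c i j * psi j y))"
    unfolding c_def by (simp add: B.expansion[OF y])
  \<comment> \<open>\<open>F\<close> is complex-valued, so it enters the conjugated factor as its
    own conjugate, next to the overlap that permits the exchange.\<close>
  also have "\<dots> = (\<Sum>i\<in>I. \<Sum>j\<in>J. cnj (cnj (F (lam i)) * c i j) * phi i x * cnj (psi j y))"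
    by (simp add: sum_distrib_left mult_ac)
  also have "\<dots> = (\<Sum>i\<in>I. \<Sum>j\<in>J. cnj (cnj (F (mu j)) * c i j) * phi i x * cnj (psi j y))"
  proof (intro sum.cong refl)
    fix i j assume "i \<in> I" "j \<in> J"
    then have "cnj (F (lam i)) * c i j = cnj (F (mu j)) * c i j"
      using F_eq by (cases "c i j = 0") auto
    then show "cnj (cnj (F (lam i)) * c i j) * phi i x * cnj (psi j y)
      = cnj (cnj (F (mu j)) * c i j) * phi i x * cnj (psi j y)" by simp
  qed
  also have "\<dots> = (\<Sum>j\<in>J. F (mu j) * (\<Sum>i\<in>I. cnj (c i j) * phi i x) * cnj (psi j y))"
    unfolding sum_distrib_left sum_distrib_right
    by (subst sum.swap) (simp add: mult_ac)
  \<comment> \<open>The conjugates of \<open>c i j\<close> are the coefficients of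
    \<open>psi j\<close> in the basis \<open>phi\<close>, so the inner sum rebuilds
    \<open>psi j x\<close>.\<close>
  also have "\<dots> = (\<Sum>j\<in>J. F (mu j) * psi j x * cnj (psi j y))"
    using A.expansion[OF x, where f = "psi _"] by (simp add: c_def mult_ac)
  finally show ?thesis .
qed

section \<open>The Laplacian and the Dirichlet form of a regular graph\<close>

locale regular_pair_graph = pair_graph G for G :: "'a pair_pre_digraph" +
  fixes \<delta> :: nat
  assumes regular: "regular_graph G \<delta>" and degree_pos: "\<delta> \<ge> 1"
begin

lemma finite_pverts: "finite (pverts G)"
  using finite_verts by simp

lemma finite_parcs: "finite (parcs G)"
  using finite_arcs by simp

lemma parcs_sym: "(x, y) \<in> parcs G \<longleftrightarrow> (y, x) \<in> parcs G"
  using arcs_symmetric by auto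

lemma not_parcs_refl: "(x, x) \<notin> parcs G"
  using no_loops' by auto

lemma card_neighbours: "x \<in> pverts G \<Longrightarrow> card {y. (x, y) \<in> parcs G} = \<delta>"
proof -
  assume "x \<in> pverts G"
  then have "card (out_arcs (with_proj G) x) = \<delta>"
    using regular by (simp add: regular_graph_def out_degree_def)
  moreover have "out_arcs (with_proj G) x = Pair x ` {y. (x, y) \<in> parcs G}"
    by (auto simp: out_arcs_def)
  ultimately show ?thesis
    by (metis card_image inj_onI prod.inject)
qed

lemma sum_parcs:
  fixes h :: "'a \<Rightarrow> 'a \<Rightarrow> 'c :: comm_monoid_add"
  shows "(\<Sum>(x, y)\<in>parcs G. h x y) = (\<Sum>x\<in>pverts G. \<Sum>y | (x, y) \<in> parcs G. h x y)"
proof -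
  have "parcs G = (SIGMA x:pverts G. {y. (x, y) \<in> parcs G})"
    using in_arcsD1 by auto
  moreover have "finite {y. (x, y) \<in> parcs G}" for x
    by (rule finite_subset[OF _ finite_pverts]) (auto dest: in_arcsD2)
  ultimately show ?thesis
    using sum.Sigma[OF finite_pverts, of "\<lambda>x. {y. (x, y) \<in> parcs G}" h] by simp
qed

lemma sum_parcs_swap:
  fixes h :: "'a \<Rightarrow> 'a \<Rightarrow> 'c :: comm_monoid_add"
  shows "(\<Sum>(x, y)\<in>parcs G. h x y) = (\<Sum>(x, y)\<in>parcs G. h y x)"
  by (rule sum.reindex_bij_witness[where i = prod.swap and j = prod.swap])
     (auto dest: parcs_sym[THEN iffD1])

lemma normalized_laplacian_hermitian:
  "normalized_laplacian G \<delta> x y = cnj (normalized_laplacian G \<delta> y x)"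
  using parcs_sym[of x y] by (simp add: normalized_laplacian_def)

lemma normalized_laplacian_apply:
  assumes x: "x \<in> pverts G"
  shows "(\<Sum>y\<in>pverts G. normalized_laplacian G \<delta> x y * f y)
       = f x - (\<Sum>y | (x, y) \<in> parcs G. f y) / of_nat \<delta>"
proof -
  have "(\<Sum>y\<in>pverts G. normalized_laplacian G \<delta> x y * f y)
      = (\<Sum>y\<in>pverts G. (if x = y then f y else 0) - (if (x, y) \<in> parcs G then f y / of_nat \<delta> else 0))"
    \<comment> \<open>Absence of loops keeps the diagonal and the adjacency part disjoint, so the
      nested conditional is a difference of two indicators.\<close>
    by (intro sum.cong) (auto simp: normalized_laplacian_def not_parcs_refl)
  also have "\<dots> = f x - (\<Sum>y\<in>pverts G. if (x, y) \<in> parcs G then f y / of_nat \<delta> else 0)"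
    using x finite_pverts by (simp add: sum_subtractf)
  also have "(\<Sum>y\<in>pverts G. if (x, y) \<in> parcs G then f y / of_nat \<delta> else 0)
      = (\<Sum>y | (x, y) \<in> parcs G. f y / of_nat \<delta>)"
    by (subst sum.inter_filter[symmetric, OF finite_pverts])
       (auto intro!: sum.cong dest: in_arcsD2)
  finally show ?thesis by (simp add: sum_divide_distrib)
qed

lemma eigenbasis_of_orthonormal_eigensystem:
  assumes "orthonormal_eigensystem G \<delta> lam phi"
  shows "eigenbasis (pverts G) (normalized_laplacian G \<delta>) {..<card (pverts G)} lam phi"
proof
  show "normalized_laplacian G \<delta> x y = cnj (normalized_laplacian G \<delta> y x)" for x y
    by (rule normalized_laplacian_hermitian)
qed (use assms finite_pverts in \<open>auto simp: orthonormal_eigensystem_def\<close>)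

text \<open>The sign \<open>s = 1\<close> yields \<open>\<mu> \<ge> 0\<close>, the sign \<open>s = - 1\<close> yields \<open>\<mu> \<le> 2\<close>.\<close>

lemma dirichlet_form:
  fixes s \<mu> :: real
  assumes f: "\<And>x. x \<in> pverts G \<Longrightarrow>
      (\<Sum>y\<in>pverts G. normalized_laplacian G \<delta> x y * f y) = of_real \<mu> * f x"
    and s: "s\<^sup>2 = 1"
  shows "(\<Sum>(x, y)\<in>parcs G. (cmod (f x - of_real s * f y))\<^sup>2)
       = 2 * real \<delta> * (1 - s * (1 - \<mu>)) * (\<Sum>x\<in>pverts G. (cmod (f x))\<^sup>2)"
proof -
  define N where "N = (\<Sum>x\<in>pverts G. (cmod (f x))\<^sup>2)"
  \<comment> \<open>The eigenvalue equation solved for the neighbour sum: \<open>f\<close> is an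
    eigenvector of the adjacency matrix for \<delta> times (1 - \<mu>).\<close>
  have nbr: "(\<Sum>y | (x, y) \<in> parcs G. f y) = of_real (real \<delta> * (1 - \<mu>)) * f x"
    if "x \<in> pverts G" for x
  proof -
    have "f x - (\<Sum>y | (x, y) \<in> parcs G. f y) / of_nat \<delta> = of_real \<mu> * f x"
      using f[OF that] normalized_laplacian_apply[OF that] by simp
    then show ?thesis using degree_pos by (simp add: field_simps)
  qed
  have diag: "(\<Sum>(x, y)\<in>parcs G. (cmod (f x))\<^sup>2) = real \<delta> * N"
    by (simp add: sum_parcs card_neighbours N_def sum_distrib_left)
  have cross: "(\<Sum>(x, y)\<in>parcs G. Re (cnj (f x) * f y)) = real \<delta> * (1 - \<mu>) * N"
  proof -
    have "(\<Sum>(x, y)\<in>parcs G. Re (cnj (f x) * f y))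
        = (\<Sum>x\<in>pverts G. Re (cnj (f x) * (\<Sum>y | (x, y) \<in> parcs G. f y)))"
      by (simp only: sum_parcs sum_distrib_left Re_sum)
    also have "\<dots> = (\<Sum>x\<in>pverts G. real \<delta> * (1 - \<mu>) * (cmod (f x))\<^sup>2)"
    proof (intro sum.cong refl)
      fix x assume "x \<in> pverts G"
      then have "cnj (f x) * (\<Sum>y | (x, y) \<in> parcs G. f y)
          = of_real (real \<delta> * (1 - \<mu>)) * (f x * cnj (f x))"
        using nbr by (simp add: mult_ac)
      then show "Re (cnj (f x) * (\<Sum>y | (x, y) \<in> parcs G. f y)) = real \<delta> * (1 - \<mu>) * (cmod (f x))\<^sup>2"
        by (simp add: complex_mult_cnj cmod_power2)
    qed
    finally show ?thesis by (simp add: N_def sum_distrib_left)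
  qed
  have "(cmod (f x - of_real s * f y))\<^sup>2
      = (cmod (f x))\<^sup>2 + (cmod (f y))\<^sup>2 - 2 * s * Re (cnj (f x) * f y)" for x y
  proof -
    have "(cmod (f x - of_real s * f y))\<^sup>2
      = (cmod (f x))\<^sup>2 + s\<^sup>2 * (cmod (f y))\<^sup>2 - 2 * s * Re (cnj (f x) * f y)"
      unfolding cmod_power2 by (simp add: power2_eq_square algebra_simps)
    then show ?thesis using s by simp
  qed
  then have "(\<Sum>(x, y)\<in>parcs G. (cmod (f x - of_real s * f y))\<^sup>2)
      = (\<Sum>(x, y)\<in>parcs G. (cmod (f x))\<^sup>2) + (\<Sum>(x, y)\<in>parcs G. (cmod (f y))\<^sup>2)
        - 2 * s * (\<Sum>(x, y)\<in>parcs G. Re (cnj (f x) * f y))"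
    by (simp only: case_prod_unfold sum_subtractf sum.distrib sum_distrib_left)
  \<comment> \<open>Reversing every arc exchanges heads and tails, so this sum equals the one over
    tails.\<close>
  also have "(\<Sum>(x, y)\<in>parcs G. (cmod (f y))\<^sup>2) = real \<delta> * N"
    using sum_parcs_swap[of "\<lambda>x y. (cmod (f x))\<^sup>2"] diag by simp
  finally show ?thesis
    unfolding diag cross N_def[symmetric] by (simp add: algebra_simps)
qed

end

section \<open>Spectrum of a connected regular graph\<close>

locale regular_graph_spectrum = regular_pair_graph G \<delta> for G :: "'a pair_pre_digraph" and \<delta> +
  fixes lam :: "nat \<Rightarrow> real" and phi :: "nat \<Rightarrow> 'a \<Rightarrow> complex"
  assumes connected: "Digraph_Component.connected (with_proj G)"
    and eigensystem: "orthonormal_eigensystem G \<delta> lam phi"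
begin

sublocale eigenbasis "pverts G" "normalized_laplacian G \<delta>" "{..<card (pverts G)}" lam phi
  by (rule eigenbasis_of_orthonormal_eigensystem[OF eigensystem])

lemma norm_phi: "i < card (pverts G) \<Longrightarrow> (\<Sum>x\<in>pverts G. (cmod (phi i x))\<^sup>2) = 1"
proof -
  assume "i < card (pverts G)"
  then have "complex_of_real (\<Sum>x\<in>pverts G. (cmod (phi i x))\<^sup>2) = of_real 1"
    using ortho[of i i]
    by (simp only: of_real_sum complex_norm_square of_real_1 lessThan_iff if_True simp_thms)
  then show ?thesis by (simp only: of_real_eq_iff)
qed

text \<open>The Dirichlet form is a sum of squares and \<open>phi i\<close> has norm 1, so the
  factor in front of the norm is non-negative for both signs. The upper bound 2 later keeps the
  poles inside the contour.\<close>

lemma lam_bounds: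
  assumes "i < card (pverts G)"
  shows "0 \<le> lam i" "lam i \<le> 2"
proof -
  have eig: "(\<Sum>y\<in>pverts G. normalized_laplacian G \<delta> x y * phi i y) = of_real (lam i) * phi i x"
    if "x \<in> pverts G" for x
    using assms that by (intro eigen) auto
  have "0 \<le> 2 * real \<delta> * (1 - s * (1 - lam i))" if "s\<^sup>2 = 1" for s
  proof -
    have "0 \<le> (\<Sum>(x, y)\<in>parcs G. (cmod (phi i x - of_real s * phi i y))\<^sup>2)"
      by (intro sum_nonneg) auto
    then show ?thesis
      using dirichlet_form[OF eig that] norm_phi[OF assms] by simp
  qed
  from this[of 1] this[of "-1"] show "0 \<le> lam i" "lam i \<le> 2"
    using degree_pos by (auto simp: zero_le_mult_iff)
qed

lemma sum_split_zero_eigenvalue: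
  "(\<Sum>i<card (pverts G). h i) = (\<Sum>i | i < card (pverts G) \<and> 0 < lam i. h i)
      + (\<Sum>i | i < card (pverts G) \<and> lam i = 0. h i)"
  by (subst sum.union_disjoint[symmetric])
     (auto intro!: sum.cong dest: lam_bounds(1))

text \<open>For eigenvalue 0 the Dirichlet form with \<open>s = 1\<close> vanishes, hence so does
  each of its squares: values agree along every arc, and connectedness carries this to all
  vertices.\<close>

lemma phi_constant:
  assumes i: "i < card (pverts G)" and "lam i = 0"
    and x: "x \<in> pverts G" and y: "y \<in> pverts G"
  shows "phi i x = phi i y"
proof -
  have eig: "(\<Sum>y\<in>pverts G. normalized_laplacian G \<delta> x y * phi i y) = of_real (lam i) * phi i x"
    if "x \<in> pverts G" for x
    using i that by (intro eigen) auto
  have "(\<Sum>e\<in>parcs G. (cmod (phi i (fst e) - phi i (snd e)))\<^sup>2) = 0"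
    using dirichlet_form[OF eig, of 1] \<open>lam i = 0\<close> by (simp add: case_prod_beta)
  then have arc: "phi i u = phi i v" if "(u, v) \<in> parcs G" for u v
    using that sum_nonneg_eq_0_iff[OF finite_parcs, of "\<lambda>e. (cmod (phi i (fst e) - phi i (snd e)))\<^sup>2"]
    by simp (metis fst_conv snd_conv)
  have "strongly_connected (with_proj G)"
    using symmetric_connected_imp_strongly_connected connected sym_arcs by simp
  then have "x \<rightarrow>\<^sup>*\<^bsub>with_proj G\<^esub> y"
    using x y by auto
  then show ?thesis
    by (induct rule: reachable_induct) (auto dest: arc)
qed

text \<open>The constant function 1 lies in the kernel, so its expansion involves only eigenvectors
  for 0. These are constant, hence their coefficients are \<open>?n * cnj (phi i y)\<close>, and
  evaluating the expansion at \<open>x\<close> gives 1 as \<open>?n\<close> times the required sum.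
  The multiplicity of the eigenvalue 0 does not enter.\<close>

lemma zero_eigenvalue_projection:
  assumes x: "x \<in> pverts G" and y: "y \<in> pverts G"
  shows "(\<Sum>i | i < card (pverts G) \<and> lam i = 0. phi i x * cnj (phi i y)) = 1 / of_nat (card (pverts G))"
proof -
  let ?n = "card (pverts G)"
  have n: "?n > 0" using x finite_pverts by (auto simp: card_gt_0_iff)
  have one: "(\<Sum>z\<in>pverts G. normalized_laplacian G \<delta> u z * 1) = of_real 0 * 1"
    if "u \<in> pverts G" for u
    using that normalized_laplacian_apply[of u "\<lambda>_. 1"] card_neighbours degree_pos by simp
  have coeff: "(\<Sum>z\<in>pverts G. 1 * cnj (phi i z)) = (if lam i = 0 then of_nat ?n * cnj (phi i y) else 0)"
    if "i < ?n" for i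
  proof (cases "lam i = 0")
    case True
    then have "(\<Sum>z\<in>pverts G. 1 * cnj (phi i z)) = (\<Sum>z\<in>pverts G. cnj (phi i y))"
      using phi_constant[OF that True _ y] by (intro sum.cong) auto
    then show ?thesis using True by simp
  next
    case False
    then show ?thesis using eigenvectors_orthogonal[of "\<lambda>_. 1" 0 i] one that by simp
  qed
  have "1 = (\<Sum>i<?n. (\<Sum>z\<in>pverts G. 1 * cnj (phi i z)) * phi i x)"
    using expansion[OF x, of "\<lambda>_. 1"] by simp
  also have "\<dots> = (\<Sum>i<?n. if lam i = 0 then of_nat ?n * (phi i x * cnj (phi i y)) else 0)"
    by (intro sum.cong refl, subst coeff) auto
  also have "\<dots> = (\<Sum>i | i < ?n \<and> lam i = 0. of_nat ?n * (phi i x * cnj (phi i y)))"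
    by (subst sum.inter_filter[symmetric]) auto
  finally show ?thesis
    using n unfolding sum_distrib_left[symmetric]
    by (metis nonzero_mult_div_cancel_left of_nat_0_eq_iff less_irrefl)
qed

text \<open>Two constant functions are orthogonal only if one of them is zero, which the norm 1
  excludes.\<close>

lemma zero_eigenvalue_simple:
  assumes "i < card (pverts G)" "j < card (pverts G)" "lam i = 0" "lam j = 0"
  shows "i = j"
proof (rule ccontr)
  assume "i \<noteq> j"
  obtain z where z: "z \<in> pverts G" using assms(1) by (metis card.empty ex_in_conv not_less0)
  have "(\<Sum>x\<in>pverts G. phi i x * cnj (phi j x)) = (\<Sum>x\<in>pverts G. phi i z * cnj (phi j z))"
    using assms phi_constant[OF _ _ _ z] by (intro sum.cong) auto
  then have "phi i z = 0 \<or> phi j z = 0"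
    using ortho[of i j] \<open>i \<noteq> j\<close> assms finite_pverts z by auto
  then obtain k where k: "k < card (pverts G)" "lam k = 0" "phi k z = 0"
    using assms by blast
  then have "phi k x = 0" if "x \<in> pverts G" for x
    using phi_constant[OF k(1,2) that z] by simp
  then show False using norm_phi[OF k(1)] by simp
qed

text \<open>A vertex of positive degree has a neighbour other than itself. This makes 1 a legitimate
  eigenvalue index, so that \<open>lam 1\<close> is meaningful.\<close>

lemma card_pverts_ge_2: "x \<in> pverts G \<Longrightarrow> card (pverts G) \<ge> 2"
proof -
  assume x: "x \<in> pverts G"
  then obtain y where y: "(x, y) \<in> parcs G"
    using card_neighbours[OF x] degree_pos by (metis (mono_tags, lifting) card.empty empty_Collect_eq not_one_le_zero)
  then have "x \<noteq> y" "y \<in> pverts G" using not_parcs_refl in_arcsD2 by auto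
  then have "card {x, y} = 2" "{x, y} \<subseteq> pverts G" using x by auto
  then show ?thesis using card_mono[OF finite_pverts] by metis
qed

text \<open>The kernel projection is nonzero, so 0 occurs as an eigenvalue; by monotonicity
  \<open>lam 0\<close> is then at most 0, and a positive eigenvalue must have index at least
  1.\<close>

lemma lam_1_le:
  assumes x: "x \<in> pverts G" and mono: "mono_on {..<card (pverts G)} lam"
    and j: "j < card (pverts G)" "0 < lam j"
  shows "lam 1 \<le> lam j"
proof -
  have "{i. i < card (pverts G) \<and> lam i = 0} \<noteq> {}"
  proof
    assume "{i. i < card (pverts G) \<and> lam i = 0} = {}"
    then show False using zero_eigenvalue_projection[OF x x] j by (simp del: Collect_empty_eq)
  qed
  then obtain i where i: "i < card (pverts G)" "lam i = 0" by blast
  then have "lam 0 \<le> 0" using mono_onD[OF mono, of 0 i] by auto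
  then have "1 \<le> j" using j(2) by (cases j) auto
  then show ?thesis using mono_onD[OF mono, of 1 j] j by auto
qed

text \<open>If \<open>lam 1\<close> were 0, then \<open>lam 0\<close>, squeezed between 0 and
  \<open>lam 1\<close>, would be 0 as well, against simplicity of the eigenvalue 0.\<close>

lemma lam_1_pos:
  assumes "x \<in> pverts G" and mono: "mono_on {..<card (pverts G)} lam"
  shows "0 < lam 1"
proof -
  have n: "1 < card (pverts G)" using card_pverts_ge_2[OF assms(1)] by simp
  then have "lam 0 \<le> lam 1" using mono by (auto simp: mono_on_def)
  then show ?thesis
    using lam_bounds[of 0] lam_bounds[of 1] zero_eigenvalue_simple[of 0 1] n by force
qed

end

section \<open>The Cartesian product and its tensor eigenbasis\<close>

text \<open>The product Laplacian is a Kronecker sum of the two Laplacians with weights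
  \<open>d / (d + d')\<close> and \<open>d' / (d + d')\<close>: each factor acts on its own
  coordinate and the other coordinate contributes an identity matrix.\<close>

lemma cartesian_product_laplacian:
  assumes "d \<ge> 1" "d' \<ge> 1" "x \<in> pverts G" "x' \<in> pverts H"
    and "\<And>x. (x, x) \<notin> parcs G" "\<And>x. (x, x) \<notin> parcs H"
  shows "normalized_laplacian (cartesian_product G H) (d + d') (x, x') (y, y') =
      (of_nat d * normalized_laplacian G d x y * (if x' = y' then 1 else 0)
      + of_nat d' * normalized_laplacian H d' x' y' * (if x = y then 1 else 0)) / of_nat (d + d')"
proof -
  have "of_nat d + of_nat d' \<noteq> (0::complex)"
    using assms(1) by (metis add_is_0 not_one_le_zero of_nat_add of_nat_eq_0_iff)
  then show ?thesis
    using assms by (auto simp: normalized_laplacian_def cartesian_product_def)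
qed

lemma eigenbasis_cartesian_product:
  assumes "regular_graph_spectrum G d lam phi" and "regular_graph_spectrum H d' lam' phi'"
  shows "eigenbasis (pverts G \<times> pverts H) (normalized_laplacian (cartesian_product G H) (d + d'))
    ({..<card (pverts G)} \<times> {..<card (pverts H)})
    (\<lambda>(i, j). (real d * lam i + real d' * lam' j) / real (d + d'))
    (\<lambda>(i, j) (x, y). phi i x * phi' j y)"
proof -
  interpret A: regular_graph_spectrum G d lam phi by fact
  interpret B: regular_graph_spectrum H d' lam' phi' by fact
  have lap: "normalized_laplacian (cartesian_product G H) (d + d') (x, x') (y, y') =
      (of_nat d * normalized_laplacian G d x y * (if x' = y' then 1 else 0)
      + of_nat d' * normalized_laplacian H d' x' y' * (if x = y then 1 else 0)) / of_nat (d + d')"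
    if "x \<in> pverts G" "x' \<in> pverts H" for x x' y y'
    using that A.degree_pos B.degree_pos A.not_parcs_refl B.not_parcs_refl
    by (intro cartesian_product_laplacian)
  show ?thesis
  proof
    fix p q assume "p \<in> pverts G \<times> pverts H" "q \<in> pverts G \<times> pverts H"
    then show "normalized_laplacian (cartesian_product G H) (d + d') p q
        = cnj (normalized_laplacian (cartesian_product G H) (d + d') q p)"
      using A.normalized_laplacian_hermitian[of "fst p" "fst q"]
        B.normalized_laplacian_hermitian[of "snd p" "snd q"]
      by (auto simp: lap)
  next
    fix k p assume kp: "k \<in> {..<card (pverts G)} \<times> {..<card (pverts H)}" "p \<in> pverts G \<times> pverts H"
    obtain i j where k: "k = (i, j)" "i < card (pverts G)" "j < card (pverts H)" using kp by auto
    obtain x x' where p: "p = (x, x')" "x \<in> pverts G" "x' \<in> pverts H" using kp by auto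
    \<comment> \<open>The identity factor collapses the sum over \<open>y'\<close>, and the
      eigenvalue equation of the first graph remains. The fact \<open>2\<close> is the mirror image,
      with the sums swapped first.\<close>
    have 1: "(\<Sum>y\<in>pverts G. \<Sum>y'\<in>pverts H. of_nat d * normalized_laplacian G d x y
          * (if x' = y' then 1 else 0) * (phi i y * phi' j y'))
        = of_nat d * (of_real (lam i) * phi i x) * phi' j x'"
    proof -
      have "(\<Sum>y'\<in>pverts H. of_nat d * normalized_laplacian G d x y
          * (if x' = y' then 1 else 0) * (phi i y * phi' j y'))
          = of_nat d * (normalized_laplacian G d x y * phi i y) * phi' j x'" for y
        using p B.finite_pverts by (simp add: if_distrib if_distribR cong: if_cong)
      then show ?thesis
        using A.eigen[of i x] k p by (simp add: sum_distrib_left[symmetric] sum_distrib_right[symmetric])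
    qed
    have 2: "(\<Sum>y\<in>pverts G. \<Sum>y'\<in>pverts H. of_nat d' * normalized_laplacian H d' x' y'
          * (if x = y then 1 else 0) * (phi i y * phi' j y'))
        = of_nat d' * (of_real (lam' j) * phi' j x') * phi i x"
    proof -
      have "(\<Sum>y\<in>pverts G. of_nat d' * normalized_laplacian H d' x' y'
          * (if x = y then 1 else 0) * (phi i y * phi' j y'))
          = of_nat d' * (normalized_laplacian H d' x' y' * phi' j y') * phi i x" for y'
        using p A.finite_pverts by (simp add: if_distrib if_distribR cong: if_cong)
      then show ?thesis
        using B.eigen[of j x'] k p
        by (subst sum.swap) (simp add: sum_distrib_left[symmetric] sum_distrib_right[symmetric])
    qed
    have "(\<Sum>q\<in>pverts G \<times> pverts H. normalized_laplacian (cartesian_product G H) (d + d') p q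
          * (case k of (i, j) \<Rightarrow> \<lambda>(x, y). phi i x * phi' j y) q)
        = (\<Sum>y\<in>pverts G. \<Sum>y'\<in>pverts H. (of_nat d * normalized_laplacian G d x y
              * (if x' = y' then 1 else 0) * (phi i y * phi' j y')
            + of_nat d' * normalized_laplacian H d' x' y'
              * (if x = y then 1 else 0) * (phi i y * phi' j y')) / of_nat (d + d'))"
      unfolding k p sum.cartesian_product
      by (intro sum.cong refl) (clarsimp simp only: lap[OF p(2,3)] case_prod_conv
          ring_distribs times_divide_eq_left)
    also have "\<dots> = (of_nat d * (of_real (lam i) * phi i x) * phi' j x'
        + of_nat d' * (of_real (lam' j) * phi' j x') * phi i x) / of_nat (d + d')"
      by (simp only: sum_divide_distrib[symmetric] sum.distrib 1 2)
    finally show "(\<Sum>q\<in>pverts G \<times> pverts H. normalized_laplacian (cartesian_product G H) (d + d') p q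
          * (case k of (i, j) \<Rightarrow> \<lambda>(x, y). phi i x * phi' j y) q)
        = of_real (case k of (i, j) \<Rightarrow> (real d * lam i + real d' * lam' j) / real (d + d'))
          * (case k of (i, j) \<Rightarrow> \<lambda>(x, y). phi i x * phi' j y) p"
      unfolding k p by (simp add: add_divide_distrib ring_distribs mult_ac)
  next
    fix k l assume kl: "k \<in> {..<card (pverts G)} \<times> {..<card (pverts H)}"
      "l \<in> {..<card (pverts G)} \<times> {..<card (pverts H)}"
    obtain i j where k: "k = (i, j)" "i < card (pverts G)" "j < card (pverts H)" using kl by auto
    obtain i' j' where l: "l = (i', j')" "i' < card (pverts G)" "j' < card (pverts H)" using kl by auto
    \<comment> \<open>The inner product of two tensors is the product of the inner products of their
      factors.\<close>
    have "(\<Sum>p\<in>pverts G \<times> pverts H. (case k of (i, j) \<Rightarrow> \<lambda>(x, y). phi i x * phi' j y) p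
          * cnj ((case l of (i, j) \<Rightarrow> \<lambda>(x, y). phi i x * phi' j y) p))
        = (\<Sum>x\<in>pverts G. phi i x * cnj (phi i' x)) * (\<Sum>y\<in>pverts H. phi' j y * cnj (phi' j' y))"
      unfolding k l sum_product sum.cartesian_product
      by (intro sum.cong refl) (simp add: case_prod_beta mult_ac)
    then show "(\<Sum>p\<in>pverts G \<times> pverts H. (case k of (i, j) \<Rightarrow> \<lambda>(x, y). phi i x * phi' j y) p
          * cnj ((case l of (i, j) \<Rightarrow> \<lambda>(x, y). phi i x * phi' j y) p)) = (if k = l then 1 else 0)"
      using A.ortho[of i i'] B.ortho[of j j'] k l by simp
  qed (use A.finite_pverts B.finite_pverts in \<open>auto simp: card_cartesian_product\<close>)
qed

section \<open>The Cauchy integral of a pair of resolvent factors\<close>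

text \<open>The circle meets the real axis at \<open>d' * c / 2\<close> and
  \<open>2 * d' + d' * c / 2\<close>. It therefore encloses the pole \<open>d' * b\<close>, which
  lies between \<open>d' * c\<close> and \<open>2 * d'\<close>, and leaves the pole
  \<open>- d * a\<close> outside; Cauchy's formula at \<open>d' * b\<close> gives the value. In the
  theorem \<open>c\<close> is the smallest positive eigenvalue \<open>lam' 1\<close>.\<close>

lemma green_kernel_has_contour_integral:
  fixes a b c d d' :: real
  assumes "d > 0" "d' > 0" "a > 0" "c > 0" "c \<le> b" "b \<le> 2"
  shows "((\<lambda>\<alpha>. 1 / (of_real a + \<alpha> / of_real d) * (1 / (of_real b + - \<alpha> / of_real d')))
      has_contour_integral (2 * of_real pi * \<i> * of_real d * of_real d' / of_real (d * a + d' * b)))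
      (reversepath (circlepath (of_real (d' + d' * c / 2)) d'))"
proof -
  let ?z = "complex_of_real (d' + d' * c / 2)" and ?w = "complex_of_real (d' * b)"
  let ?f = "\<lambda>\<alpha>. - of_real d' / (of_real a + \<alpha> / of_real d)"
  \<comment> \<open>The closed disc lies in the open right half-plane, whereas this factor vanishes
    only at the negative number \<open>- d * a\<close>.\<close>
  have nz: "of_real a + \<alpha> / of_real d \<noteq> 0" if "\<alpha> \<in> cball ?z d'" for \<alpha> :: complex
  proof
    assume "of_real a + \<alpha> / of_real d = 0"
    then have "Re (of_real a + \<alpha> / of_real d) = 0" by simp
    then have "a + Re \<alpha> / d = 0" by simp
    then have "Re \<alpha> < 0" using assms(1,3) by (simp add: field_simps) (smt (verit) mult_pos_pos)
    moreover have "Re ?z - Re \<alpha> \<le> d'"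
      using that abs_Re_le_cmod[of "?z - \<alpha>"] by (simp add: dist_norm)
    moreover have "d' * c > 0" using assms by simp
    ultimately show False by simp
  qed
  have "?f holomorphic_on cball ?z d'"
    using nz assms(1) by (intro holomorphic_intros) auto
  moreover have "norm (?w - ?z) < d'"
  proof -
    have "d' * c \<le> d' * b" "d' * b \<le> d' * 2" "d' * c > 0"
      using assms by (auto intro: mult_left_mono)
    then have "\<bar>d' * b - (d' + d' * c / 2)\<bar> < d'" by linarith
    then show ?thesis
      by (simp only: of_real_diff[symmetric] norm_of_real)
  qed
  ultimately have "((\<lambda>\<alpha>. ?f \<alpha> / (\<alpha> - ?w)) has_contour_integral 2 * of_real pi * \<i> * ?f ?w)
      (circlepath ?z d')"
    by (rule Cauchy_integral_circlepath_simple)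
  \<comment> \<open>The sign from the clockwise orientation cancels the minus in \<open>?f\<close>,
    which comes from writing \<open>b - \<alpha> / d'\<close> as
    \<open>(\<alpha> - ?w) / (- d')\<close>.\<close>
  then have "((\<lambda>\<alpha>. ?f \<alpha> / (\<alpha> - ?w)) has_contour_integral - (2 * of_real pi * \<i> * ?f ?w))
      (reversepath (circlepath ?z d'))"
    by (intro has_contour_integral_reversepath) auto
  moreover have "?f \<alpha> / (\<alpha> - ?w) = 1 / (of_real a + \<alpha> / of_real d) * (1 / (of_real b + - \<alpha> / of_real d'))"
    for \<alpha> :: complex
  proof -
    have "of_real b + - \<alpha> / of_real d' = (\<alpha> - ?w) / - of_real d'"
      using assms(2) by (simp add: field_simps)
    then show ?thesis by (simp only: divide_divide_eq_right times_divide_eq_left times_divide_eq_right mult_1 mult_1_right)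
  qed
  moreover have "- (2 * of_real pi * \<i> * ?f ?w)
      = 2 * of_real pi * \<i> * of_real d * of_real d' / of_real (d * a + d' * b)"
  proof -
    have "of_real a + ?w / of_real d = of_real (d * a + d' * b) / of_real d"
      using assms(1) by (simp add: field_simps)
    then show ?thesis by simp
  qed
  ultimately show ?thesis by simp
qed

section \<open>Assembling the Green's function of the product\<close>

theorem theorem10:
  fixes \<Gamma> :: "'a pair_pre_digraph" and \<Gamma>' :: "'b pair_pre_digraph"
    and d d' m n :: nat
    and lam lam' Lam :: "nat \<Rightarrow> real"
    and phi :: "nat \<Rightarrow> 'a \<Rightarrow> complex" and phi' :: "nat \<Rightarrow> 'b \<Rightarrow> complex"
    and Phi :: "nat \<Rightarrow> 'a \<times> 'b \<Rightarrow> complex"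
    and C :: "real \<Rightarrow> complex"
    and x y :: 'a and x' y' :: 'b
  assumes "pair_graph \<Gamma>" and "Digraph_Component.connected (with_proj \<Gamma>)"
    and "regular_graph \<Gamma> d" and "d \<ge> 1"
    and "pair_graph \<Gamma>'" and "Digraph_Component.connected (with_proj \<Gamma>')"
    and "regular_graph \<Gamma>' d'" and "d' \<ge> 1"
    and "m = card (pverts \<Gamma>)" and "n = card (pverts \<Gamma>')"
    and "orthonormal_eigensystem \<Gamma> d lam phi"
    and "orthonormal_eigensystem \<Gamma>' d' lam' phi'" and "mono_on {..<n} lam'"
    and "orthonormal_eigensystem (cartesian_product \<Gamma> \<Gamma>') (d + d') Lam Phi"
    and "C = reversepath (circlepath (of_real (real d' + real d' * lam' 1 / 2)) (real d'))"
    and "x \<in> pverts \<Gamma>" and "y \<in> pverts \<Gamma>"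
    and "x' \<in> pverts \<Gamma>'" and "y' \<in> pverts \<Gamma>'"
  shows "normalized_green (cartesian_product \<Gamma> \<Gamma>') Lam Phi (x, x') (y, y') =
      of_nat (d + d') / (2 * of_real pi * \<i> * of_nat d * of_nat d') *
        contour_integral C (\<lambda>\<alpha>. generalized_green \<Gamma> lam phi (\<alpha> / of_nat d) x y *
                                 generalized_green \<Gamma>' lam' phi' (- \<alpha> / of_nat d') x' y')
      + of_nat (d + d') / (of_nat d * of_nat n) * normalized_green \<Gamma> lam phi x y
      + of_nat (d + d') / (of_nat d' * of_nat m) * normalized_green \<Gamma>' lam' phi' x' y'"
  proof -
  interpret A: regular_graph_spectrum \<Gamma> d lam phi
    using assms by (simp add: regular_graph_spectrum_def regular_graph_spectrum_axioms_def
        regular_pair_graph_def regular_pair_graph_axioms_def)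
  interpret B: regular_graph_spectrum \<Gamma>' d' lam' phi'
    using assms by (simp add: regular_graph_spectrum_def regular_graph_spectrum_axioms_def
        regular_pair_graph_def regular_pair_graph_axioms_def)
  define I where "I = {i. i < card (pverts \<Gamma>) \<and> 0 < lam i}"
  define I0 where "I0 = {i. i < card (pverts \<Gamma>) \<and> lam i = 0}"
  define J where "J = {j. j < card (pverts \<Gamma>') \<and> 0 < lam' j}"
  define J0 where "J0 = {j. j < card (pverts \<Gamma>') \<and> lam' j = 0}"
  have fin: "finite I" "finite J" by (simp_all add: I_def J_def)
  define P where "P i = phi i x * cnj (phi i y)" for i
  define Q where "Q j = phi' j x' * cnj (phi' j y')" for j
  define D where "D = real (d + d')"
  \<comment> \<open>Value 0 off the positive reals turns the Green's function into a sum over all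
    eigenvalues, the form in which \<open>spectral_function_unique\<close> applies.\<close>
  define F :: "real \<Rightarrow> complex" where "F t = (if t > 0 then 1 / of_real t else 0)" for t
  let ?mu = "\<lambda>i j. (real d * lam i + real d' * lam' j) / D"
  have pos: "d > 0" "d' > 0" "D > 0" using assms(4,8) by (simp_all add: D_def)
  have c: "0 < lam' 1" using B.lam_1_pos assms by simp

  interpret AB: eigenbasis "pverts \<Gamma> \<times> pverts \<Gamma>'"
    "normalized_laplacian (cartesian_product \<Gamma> \<Gamma>') (d + d')"
    "{..<card (pverts \<Gamma>)} \<times> {..<card (pverts \<Gamma>')}"
    "\<lambda>(i, j). (real d * lam i + real d' * lam' j) / real (d + d')"
    "\<lambda>(i, j) (x, y). phi i x * phi' j y"
    by (rule eigenbasis_cartesian_product) unfold_locales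
  have pverts_prod: "pverts (cartesian_product \<Gamma> \<Gamma>') = pverts \<Gamma> \<times> pverts \<Gamma>'"
    by (simp add: cartesian_product_def)
  have Phi: "eigenbasis (pverts \<Gamma> \<times> pverts \<Gamma>') (normalized_laplacian (cartesian_product \<Gamma> \<Gamma>') (d + d'))
      {..<card (pverts \<Gamma> \<times> pverts \<Gamma>')} Lam Phi"
  proof (unfold_locales, goal_cases)
    case 4
    then show ?case by (rule AB.hermitian)
  qed (use AB.finite_V assms(14) in \<open>auto simp: orthonormal_eigensystem_def pverts_prod\<close>)

  have "normalized_green (cartesian_product \<Gamma> \<Gamma>') Lam Phi (x, x') (y, y')
      = (\<Sum>k<card (pverts \<Gamma> \<times> pverts \<Gamma>'). F (Lam k) * Phi k (x, x') * cnj (Phi k (y, y')))"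
    unfolding normalized_green_def generalized_green_def pverts_prod F_def
    by (intro sum.mono_neutral_cong_left) auto
  \<comment> \<open>The given eigensystem \<open>Phi\<close> need not consist of tensors;
    independence of the basis replaces it by the tensor basis.\<close>
  also have "\<dots> = (\<Sum>(i, j)\<in>{..<card (pverts \<Gamma>)} \<times> {..<card (pverts \<Gamma>')}. F (?mu i j) * (P i * Q j))"
    using spectral_function_unique[OF Phi AB.eigenbasis_axioms, of "(x, x')" "(y, y')" F] assms(16-19)
    by (simp add: P_def Q_def D_def case_prod_beta mult_ac)
  also have "\<dots> = (\<Sum>i<card (pverts \<Gamma>). \<Sum>j<card (pverts \<Gamma>'). F (?mu i j) * (P i * Q j))"
    by (simp add: sum.cartesian_product)
  also have "\<dots> = (\<Sum>i\<in>I. \<Sum>j\<in>J. F (?mu i j) * (P i * Q j)) + (\<Sum>i\<in>I. \<Sum>j\<in>J0. F (?mu i j) * (P i * Q j))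
      + ((\<Sum>i\<in>I0. \<Sum>j\<in>J. F (?mu i j) * (P i * Q j)) + (\<Sum>i\<in>I0. \<Sum>j\<in>J0. F (?mu i j) * (P i * Q j)))"
    unfolding A.sum_split_zero_eigenvalue B.sum_split_zero_eigenvalue sum.distrib
    by (simp add: I_def I0_def J_def J0_def)
  \<comment> \<open>Here the product eigenvalue is 0, and \<open>F 0 = 0\<close>.\<close>
  also have "(\<Sum>i\<in>I0. \<Sum>j\<in>J0. F (?mu i j) * (P i * Q j)) = 0"
    by (simp add: I0_def J0_def F_def)
  \<comment> \<open>With \<open>lam' j = 0\<close> the weight is \<open>D / (d * lam i)\<close>,
    independent of \<open>j\<close>. The double sum factors, and the kernel projection of the second
    graph supplies \<open>1 / n\<close>.\<close>
  also have "(\<Sum>i\<in>I. \<Sum>j\<in>J0. F (?mu i j) * (P i * Q j))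
      = of_nat (d + d') / (of_nat d * of_nat n) * normalized_green \<Gamma> lam phi x y"
  proof -
    have "(\<Sum>i\<in>I. \<Sum>j\<in>J0. F (?mu i j) * (P i * Q j))
        = (\<Sum>i\<in>I. \<Sum>j\<in>J0. of_real D / of_nat d * (1 / of_real (lam i) * P i) * Q j)"
      using pos by (intro sum.cong refl) (simp add: I_def J0_def F_def)
    also have "\<dots> = of_real D / of_nat d * (\<Sum>i\<in>I. 1 / of_real (lam i) * P i) * (\<Sum>j\<in>J0. Q j)"
      by (simp only: sum_distrib_left sum_distrib_right)
         (rule sum.swap)
    also have "(\<Sum>j\<in>J0. Q j) = 1 / of_nat n"
      using B.zero_eigenvalue_projection assms by (simp add: J0_def Q_def)
    also have "(\<Sum>i\<in>I. 1 / of_real (lam i) * P i) = normalized_green \<Gamma> lam phi x y"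
      by (simp add: normalized_green_def generalized_green_def I_def P_def mult.assoc)
    finally show ?thesis by (simp add: D_def)
  qed
  also have "(\<Sum>i\<in>I0. \<Sum>j\<in>J. F (?mu i j) * (P i * Q j))
      = of_nat (d + d') / (of_nat d' * of_nat m) * normalized_green \<Gamma>' lam' phi' x' y'"
  proof -
    have "(\<Sum>i\<in>I0. \<Sum>j\<in>J. F (?mu i j) * (P i * Q j))
        = (\<Sum>i\<in>I0. \<Sum>j\<in>J. P i * (of_real D / of_nat d' * (1 / of_real (lam' j) * Q j)))"
      using pos by (intro sum.cong refl) (simp add: J_def I0_def F_def)
    also have "\<dots> = (\<Sum>i\<in>I0. P i) * (of_real D / of_nat d' * (\<Sum>j\<in>J. 1 / of_real (lam' j) * Q j))"
      by (simp only: sum_distrib_left sum_distrib_right) (rule sum.swap)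
    also have "(\<Sum>i\<in>I0. P i) = 1 / of_nat m"
      using A.zero_eigenvalue_projection assms by (simp add: I0_def P_def)
    also have "(\<Sum>j\<in>J. 1 / of_real (lam' j) * Q j) = normalized_green \<Gamma>' lam' phi' x' y'"
      by (simp add: normalized_green_def generalized_green_def J_def Q_def mult.assoc)
    finally show ?thesis by (simp add: D_def)
  qed
  also have "(\<Sum>i\<in>I. \<Sum>j\<in>J. F (?mu i j) * (P i * Q j))
      = of_nat (d + d') / (2 * of_real pi * \<i> * of_nat d * of_nat d') *
        contour_integral C (\<lambda>\<alpha>. generalized_green \<Gamma> lam phi (\<alpha> / of_nat d) x y *
                                 generalized_green \<Gamma>' lam' phi' (- \<alpha> / of_nat d') x' y')"
  proof -
    \<comment> \<open>The contour integral of the \<open>(i, j)\<close> term without its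
      coefficient. The prefactor of the theorem reduces it to \<open>1 / ?mu i j\<close>, which is
      \<open>F (?mu i j)\<close> because both eigenvalues are positive.\<close>
    let ?r = "\<lambda>i j. 2 * of_real pi * \<i> * of_real (real d) * of_real (real d')
        / complex_of_real (real d * lam i + real d' * lam' j)"
    have green: "generalized_green \<Gamma> lam phi (\<alpha> / of_nat d) x y *
          generalized_green \<Gamma>' lam' phi' (- \<alpha> / of_nat d') x' y'
        = (\<Sum>i\<in>I. \<Sum>j\<in>J. P i * Q j * (1 / (of_real (lam i) + \<alpha> / of_real (real d))
            * (1 / (of_real (lam' j) + - \<alpha> / of_real (real d')))))" for \<alpha>
      unfolding generalized_green_def sum_product I_def[symmetric] J_def[symmetric] P_def Q_def
      by (intro sum.cong refl) simp
    have "((\<lambda>\<alpha>. \<Sum>i\<in>I. \<Sum>j\<in>J. P i * Q j * (1 / (of_real (lam i) + \<alpha> / of_real (real d))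
            * (1 / (of_real (lam' j) + - \<alpha> / of_real (real d')))))
        has_contour_integral (\<Sum>i\<in>I. \<Sum>j\<in>J. P i * Q j * ?r i j)) C"
      unfolding assms(15)
    \<comment> \<open>Termwise integration works with one circle for all pairs:
      \<open>lam' 1\<close> bounds every positive \<open>lam' j\<close> from below, and 2 bounds it
      from above.\<close>
    proof (intro has_contour_integral_sum fin has_contour_integral_lmul green_kernel_has_contour_integral)
      fix j assume "j \<in> J"
      then show "lam' 1 \<le> lam' j"
        using B.lam_1_le assms(10,13,18) by (simp add: J_def)
    qed (use pos c B.lam_bounds in \<open>auto simp: I_def J_def\<close>)
    then have "contour_integral C (\<lambda>\<alpha>. generalized_green \<Gamma> lam phi (\<alpha> / of_nat d) x y *
          generalized_green \<Gamma>' lam' phi' (- \<alpha> / of_nat d') x' y') = (\<Sum>i\<in>I. \<Sum>j\<in>J. P i * Q j * ?r i j)"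
      unfolding green by (rule contour_integral_unique)
    moreover have "F (?mu i j) * (P i * Q j)
        = of_nat (d + d') / (2 * of_real pi * \<i> * of_nat d * of_nat d') * (P i * Q j * ?r i j)"
      if "i \<in> I" "j \<in> J" for i j
    proof -
      have "?mu i j > 0" using that pos by (auto simp: I_def J_def intro!: divide_pos_pos add_pos_pos)
      then have "F (?mu i j) = of_nat (d + d') / complex_of_real (real d * lam i + real d' * lam' j)"
        by (simp add: F_def D_def)
      then show ?thesis using pos by simp
    qed
    ultimately show ?thesis by (simp add: sum_distrib_left)
  qed
  finally show ?thesis by simp
qed

end
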